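(* Let $U_0>0$, $V_0>0$ (case $\varepsilon=0$). Then there exists a unique solution $f$, with associated free-boundary position $a>0$, of the problem $$\begin{aligned} &-\tfrac12\eta f'(\eta)=[\phi'(f(\eta))f'(\eta)]' &&\text{if }0<\eta<a,\\ &f(\eta)=-V_0 &&\text{if }\eta>a,\\ &f(0)=U_0,\qquad \lim_{\eta\nearrow a}f(\eta)=0,\\ &\lim_{\eta\nearrow a}\phi'(f(\eta))f'(\eta)=-\frac{aV_0}{2}, \end{aligned}$$ where a prime on $f$ or on a bracket denotes differentiation with respect to $\eta$.
   Context: $\phi\in C^2(\mathbb{R})$ is such that $\phi$ and $\phi'$ are strictly increasing on $[0,\infty)$, $\phi(s)>0$ for $s>0$, $\phi(0)=\phi'(0)=0$, and $\int_0^1\frac{\phi'(s)}{s}\,ds<\infty$, $\int_1^\infty\frac{\phi'(s)}{s}\,ds=\infty$. The constant $a>0$ is part of the unknown. A solution is a function $f:[0,\infty)\setminus\{a\}\to\mathbb{R}$ together with $a>0$ such that $f$ is continuous and positive on $[0,a)$, $C^2$ on $(0,a)$, and all the relations hold. *)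

theory Defs
  imports "HOL-Analysis.Analysis"
begin

text \<open>Meant for open \<open>S\<close> only, since \<^const>\<open>deriv\<close> is the two-sided derivative.\<close>

definition C2_on :: "(real \<Rightarrow> real) \<Rightarrow> real set \<Rightarrow> bool" where
  "C2_on f S \<longleftrightarrow>
     (\<forall>x\<in>S. f differentiable (at x)) \<and>
     (\<forall>x\<in>S. deriv f differentiable (at x)) \<and>
     continuous_on S (deriv (deriv f))"

text \<open>
  The pair \<open>(f, a)\<close> solves the free boundary problem with nonlinearity \<open>\<phi>\<close> and data \<open>U0\<close>, \<open>V0\<close>.
  Only the values of \<open>f\<close> on \<open>{0..} - {a}\<close> matter; the value at \<open>a\<close> and the values
  on the negative half-line are irrelevant and left unconstrained.
\<close>

definition fb_solution ::
    "(real \<Rightarrow> real) \<Rightarrow> real \<Rightarrow> real \<Rightarrow> (real \<Rightarrow> real) \<Rightarrow> real \<Rightarrow> bool" where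
  "fb_solution \<phi> U0 V0 f a \<longleftrightarrow>
     a > 0 \<and>
     continuous_on {0..<a} f \<and>
     (\<forall>\<eta>\<in>{0..<a}. f \<eta> > 0) \<and>
     C2_on f {0<..<a} \<and>
     (\<forall>\<eta>\<in>{0<..<a}.
        ((\<lambda>x. deriv \<phi> (f x) * deriv f x) has_real_derivative - (1/2) * \<eta> * deriv f \<eta>) (at \<eta>)) \<and>
     (\<forall>\<eta>>a. f \<eta> = - V0) \<and>
     f 0 = U0 \<and>
     (f \<longlongrightarrow> 0) (at_left a) \<and>
     ((\<lambda>\<eta>. deriv \<phi> (f \<eta>) * deriv f \<eta>) \<longlongrightarrow> - (a * V0 / 2)) (at_left a)"

end

theory Submission
  imports Defs
begin

text \<open>
  Along a solution the flux \<open>\<phi>'(f) f'\<close> is negative, so \<open>f\<close> decreases and its value \<open>u = f(\<eta>)\<close> can serve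
  as independent variable. Put \<open>G(u) = - 2 \<phi>'(f) f'\<close>. The equation says \<open>G'(u) = \<eta>\<close>, and hence
  \<open>G'' = - 2 \<phi>'(u) / G\<close> on \<open>(0, U0)\<close> with \<open>G(0) = a V0\<close>, \<open>G'(0) = a\<close> and \<open>G'(U0) = 0\<close>. In this form the
  free boundary is no longer singular, since \<open>G\<close> stays positive: a shooting argument in \<open>a\<close> produces a
  profile \<open>G\<close>, and \<open>f\<close> is the inverse function of \<open>G'\<close>. Uniqueness follows by comparing the
  flux of an arbitrary solution with this \<open>G\<close> through a monotone product.
\<close>

section \<open>Integral inequalities and globally Lipschitz initial value problems\<close>

text \<open>With \<open>I\<close> the integral of \<open>d\<close>, the product of
  \<open>\<epsilon> + L * I t\<close> and the integrating factor \<open>exp (- (L * t))\<close> is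
  nonincreasing, because the assumed bound says that \<open>d\<close> never exceeds
  \<open>\<epsilon> + L * I t\<close>. Its value at 0 is \<open>\<epsilon>\<close>.\<close>

lemma gronwall_integral:
  fixes d :: "real \<Rightarrow> real"
  assumes cont: "continuous_on {0..U} d" and "L \<ge> 0"
    and le: "\<And>t. t \<in> {0..U} \<Longrightarrow> d t \<le> \<epsilon> + L * integral {0..t} d"
    and t: "t \<in> {0..U}"
  shows "d t \<le> \<epsilon> * exp (L * t)"
proof -
  define I where "I = (\<lambda>t. integral {0..t} d)"
  define H where "H = (\<lambda>t. (\<epsilon> + L * I t) * exp (- (L * t)))"
  have dI: "(I has_real_derivative d s) (at s within {0..U})" if "s \<in> {0..U}" for s
    unfolding I_def using integral_has_real_derivative[OF cont that] .
  have dH: "(H has_real_derivative L * (d s - (\<epsilon> + L * I s)) * exp (- (L * s))) (at s within {0..U})"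
    if "s \<in> {0..U}" for s
    unfolding H_def
    by (auto intro!: derivative_eq_intros dI that simp: algebra_simps)
  have "H t \<le> H 0"
  proof (rule DERIV_nonpos_imp_decreasing_open[of 0 t H])
    show "0 \<le> t" using t by simp
    show "continuous_on {0..t} H"
      by (rule continuous_on_subset[of "{0..U}"])
         (use t in \<open>auto intro: DERIV_continuous_on[OF dH]\<close>)
    fix s assume s: "0 < s" "s < t"
    have "at s within {0..U} = at s"
      using s t by (intro at_within_interior) (auto simp: interior_atLeastAtMost_real)
    moreover have "L * (d s - (\<epsilon> + L * I s)) * exp (- (L * s)) \<le> 0"
      using le[of s] \<open>L \<ge> 0\<close> s t by (auto simp: I_def mult_le_0_iff)
    ultimately show "\<exists>y. (H has_real_derivative y) (at s) \<and> y \<le> 0"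
      using dH[of s] s t by auto
  qed
  also have "H 0 = \<epsilon>" by (simp add: H_def I_def)
  finally have "(\<epsilon> + L * I t) \<le> \<epsilon> * exp (L * t)"
    by (simp add: H_def exp_minus field_simps)
  with le[OF t] show ?thesis by (simp add: I_def)
qed

text \<open>The Lipschitz bound holds on the whole space, so the Picard operator contracts globally
  in a weighted norm, and the Banach fixed point reaches the end of the interval without any gluing
  of local solutions.\<close>

lemma picard_lindelof:
  fixes F :: "real \<Rightarrow> 'a::banach \<Rightarrow> 'a"
  assumes "U \<ge> 0" and "L \<ge> 0"
    and cont: "continuous_on ({0..U} \<times> UNIV) (\<lambda>(t, x). F t x)"
    and lip: "\<And>t x y. t \<in> {0..U} \<Longrightarrow> norm (F t x - F t y) \<le> L * norm (x - y)"
  shows "\<exists>y. y 0 = y0 \<and>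
             (\<forall>t\<in>{0..U}. (y has_vector_derivative F t (y t)) (at t within {0..U}))"
proof -
  \<comment> \<open>The weight \<open>exp (- \<kappa> t)\<close> makes the Picard operator a contraction on all of \<open>{0..U}\<close>.\<close>
  define \<kappa> where "\<kappa> = 2 * L + 1"
  have \<kappa>: "\<kappa> > 0" "L / \<kappa> \<le> 1/2" using \<open>L \<ge> 0\<close> by (auto simp: \<kappa>_def field_simps)
  \<comment> \<open>Clamping the argument to \<open>{0..U}\<close> extends a function on the
    interval to a bounded continuous function on the line. The complete space of such functions then
    carries the fixed point argument.\<close>
  define c where "c = (\<lambda>u::real. max 0 (min U u))"
  have c: "c u \<in> {0..U}" for u using \<open>U \<ge> 0\<close> by (auto simp: c_def)
  have c_id: "c u = u" if "u \<in> {0..U}" for u using that by (auto simp: c_def)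
  have contc: "continuous_on UNIV c" unfolding c_def by (intro continuous_intros)
  have Fcont: "continuous_on {0..U} (\<lambda>s. F s (y s))" if "continuous_on {0..U} y" for y
    using continuous_on_compose2[OF cont, of "{0..U}" "\<lambda>s. (s, y s)"] that
    by (force simp: continuous_on_Pair)
  \<comment> \<open>The Picard operator in the rescaled unknown: \<open>w s\<close> stands for
    \<open>exp (- \<kappa> * s)\<close> times the solution, and \<open>y\<close> below undoes the
    scaling.\<close>
  define P where "P = (\<lambda>w u. exp (- \<kappa> * u) *\<^sub>R
      (y0 + integral {0..u} (\<lambda>s. F s (exp (\<kappa> * s) *\<^sub>R w s))))"
  have Pcont: "continuous_on {0..U} (P w)" if "continuous_on {0..U} w" for w
    unfolding P_def
    by (intro continuous_intros indefinite_integral_continuous_1 integrable_continuous_real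
        Fcont that)
  have PB: "(\<lambda>u. P w (c u)) \<in> bcontfun" if w: "continuous_on {0..U} w" for w
  proof -
    have "continuous_on UNIV (\<lambda>u. P w (c u))"
      by (rule continuous_on_compose2[OF Pcont[OF w] contc]) (use c in auto)
    moreover have "bounded (P w ` {0..U})"
      by (intro compact_imp_bounded compact_continuous_image Pcont w) auto
    then have "bounded (range (\<lambda>u. P w (c u)))"
      by (rule bounded_subset) (use c in auto)
    ultimately show ?thesis by (simp add: bcontfun_def)
  qed
  define T where "T = (\<lambda>w::real \<Rightarrow>\<^sub>C 'a. Bcontfun (\<lambda>u. P w (c u)))"
  have wc: "continuous_on A (apply_bcontfun w)" for w :: "real \<Rightarrow>\<^sub>C 'a" and A
    by (rule continuous_on_apply_bcontfun) 
  have T: "apply_bcontfun (T w) u = P w (c u)" for w u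
    unfolding T_def by (simp add: Bcontfun_inverse PB wc)
  have contr: "dist (T w) (T v) \<le> 1/2 * dist w v" for w v
  proof (rule dist_bound)
    fix u
    define x where "x = c u"
    have x: "x \<in> {0..U}" unfolding x_def by (rule c)
    let ?f = "\<lambda>w s. F s (exp (\<kappa> * s) *\<^sub>R apply_bcontfun w s)"
    have intf: "?f w integrable_on {0..x}" for w
      by (rule integrable_continuous_real, rule continuous_on_subset[of "{0..U}"], rule Fcont)
         (use x wc in \<open>auto intro!: continuous_intros\<close>)
    \<comment> \<open>Integrating \<open>exp (\<kappa> * s)\<close> gains a factor
      \<open>1 / \<kappa>\<close>; this is what turns \<open>L\<close> into
      \<open>L / \<kappa>\<close>, at most one half.\<close>
    have hi: "((\<lambda>s. L * dist w v * exp (\<kappa> * s)) has_integral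
        (L * dist w v * exp (\<kappa> * x) / \<kappa> - L * dist w v * exp (\<kappa> * 0) / \<kappa>)) {0..x}"
      using x \<kappa> by (intro fundamental_theorem_of_calculus)
        (auto intro!: derivative_eq_intros simp flip: has_real_derivative_iff_has_vector_derivative)
    have "norm (integral {0..x} (?f w) - integral {0..x} (?f v)) =
        norm (integral {0..x} (\<lambda>s. ?f w s - ?f v s))"
      by (simp add: Henstock_Kurzweil_Integration.integral_diff intf)
    also have "\<dots> \<le> integral {0..x} (\<lambda>s. L * dist w v * exp (\<kappa> * s))"
    proof (rule integral_norm_bound_integral)
      show "(\<lambda>s. ?f w s - ?f v s) integrable_on {0..x}" by (intro integrable_diff intf)
      show "(\<lambda>s. L * dist w v * exp (\<kappa> * s)) integrable_on {0..x}" using hi by blast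
      fix s assume s: "s \<in> {0..x}"
      have "norm (?f w s - ?f v s) \<le> L * (exp (\<kappa> * s) * dist (w s) (v s))"
        using lip[of s "exp (\<kappa> * s) *\<^sub>R w s" "exp (\<kappa> * s) *\<^sub>R v s"] s x
        by (simp add: dist_norm flip: scaleR_diff_right)
      also have "\<dots> \<le> L * (exp (\<kappa> * s) * dist w v)"
        using \<open>L \<ge> 0\<close> by (intro mult_left_mono dist_bounded) auto
      finally show "norm (?f w s - ?f v s) \<le> L * dist w v * exp (\<kappa> * s)"
        by (simp add: mult_ac)
    qed
    also have "\<dots> = L / \<kappa> * dist w v * (exp (\<kappa> * x) - 1)"
      unfolding integral_unique[OF hi] using \<kappa> by (simp add: field_simps)
    also have "\<dots> \<le> 1/2 * dist w v * exp (\<kappa> * x)"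
      using \<kappa> \<open>L \<ge> 0\<close> x by (intro mult_mono) auto
    finally have *: "norm (integral {0..x} (?f w) - integral {0..x} (?f v)) \<le> 1/2 * dist w v * exp (\<kappa> * x)" .
    have "dist (T w u) (T v u) = exp (- \<kappa> * x) * norm (integral {0..x} (?f w) - integral {0..x} (?f v))"
      unfolding T P_def x_def[symmetric] dist_norm by (simp flip: scaleR_diff_right)
    also have "\<dots> \<le> exp (- \<kappa> * x) * (1/2 * dist w v * exp (\<kappa> * x))"
      by (intro mult_left_mono *) auto
    also have "\<dots> = 1/2 * dist w v" by (simp add: exp_minus)
    finally show "dist (T w u) (T v u) \<le> 1/2 * dist w v" .
  qed
  obtain w where w: "T w = w"
    using banach_fix_type[of "1/2" T] contr by auto
  define y where "y = (\<lambda>s. exp (\<kappa> * s) *\<^sub>R w s)"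
  have y: "y t = y0 + integral {0..t} (\<lambda>s. F s (y s))" if "t \<in> {0..U}" for t
  proof -
    have "w t = P w t" using T[of w t] c_id[OF that] w by simp
    then show ?thesis by (simp add: y_def P_def flip: exp_add)
  qed
  have "continuous_on {0..U} y" unfolding y_def by (intro continuous_intros wc)
  then have dI: "((\<lambda>t. y0 + integral {0..t} (\<lambda>s. F s (y s))) has_vector_derivative F t (y t))
      (at t within {0..U})" if "t \<in> {0..U}" for t
    using has_vector_derivative_add[OF has_vector_derivative_const
        integral_has_vector_derivative[OF Fcont that]] by simp
  have "\<forall>t\<in>{0..U}. (y has_vector_derivative F t (y t)) (at t within {0..U})"
    by (intro ballI has_vector_derivative_transform[OF _ y dI])
  moreover have "y 0 = y0" using y[of 0] \<open>U \<ge> 0\<close> by simp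
  ultimately show ?thesis by blast
qed

text \<open>The difference is the integral of \<open>y' - z'\<close>, so
  \<open>gronwall_integral\<close> applies to its norm with \<open>\<epsilon> * U\<close> as the
  constant. Only derivatives are compared, so the two functions may solve different equations,
  \<open>\<epsilon>\<close> measuring the gap; the shooting argument uses this for two parameter
  values.\<close>

lemma ode_dependence:
  fixes y z :: "real \<Rightarrow> 'a::banach"
  assumes dy: "\<And>t. t \<in> {0..U} \<Longrightarrow> (y has_vector_derivative y' t) (at t within {0..U})"
    and dz: "\<And>t. t \<in> {0..U} \<Longrightarrow> (z has_vector_derivative z' t) (at t within {0..U})"
    and "y 0 = z 0" and "L \<ge> 0" and "\<epsilon> \<ge> 0"
    and le: "\<And>t. t \<in> {0..U} \<Longrightarrow> norm (y' t - z' t) \<le> \<epsilon> + L * norm (y t - z t)"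
    and t: "t \<in> {0..U}"
  shows "norm (y t - z t) \<le> \<epsilon> * U * exp (L * t)"
proof (rule gronwall_integral[of U "\<lambda>t. norm (y t - z t)" L "\<epsilon> * U" t])
  have d: "((\<lambda>t. y t - z t) has_vector_derivative y' t - z' t) (at t within {0..U})"
    if "t \<in> {0..U}" for t
    using that by (intro derivative_intros dy dz)
  have c: "continuous_on {0..U} (\<lambda>t. y t - z t)"
    by (rule continuous_on_vector_derivative[OF d])
  then show cn: "continuous_on {0..U} (\<lambda>t. norm (y t - z t))" by (rule continuous_on_norm)
  fix t assume t: "t \<in> {0..U}"
  \<comment> \<open>The gauge integral recovers a function from its derivative, whether or not that
    derivative is continuous.\<close>
  have hi: "((\<lambda>s. y' s - z' s) has_integral (y t - z t - (y 0 - z 0))) {0..t}"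
    using t by (intro fundamental_theorem_of_calculus)
      (auto intro: has_vector_derivative_within_subset[OF d])
  have int: "(\<lambda>s. norm (y s - z s)) integrable_on {0..t}"
    by (rule integrable_continuous_real, rule continuous_on_subset[OF cn]) (use t in auto)
  have "norm (y t - z t) = norm (integral {0..t} (\<lambda>s. y' s - z' s))"
    using hi \<open>y 0 = z 0\<close> by (simp add: integral_unique)
  also have "\<dots> \<le> integral {0..t} (\<lambda>s. \<epsilon> + L * norm (y s - z s))"
    using hi t by (intro integral_norm_bound_integral le)
      (auto intro!: integrable_add integrable_on_mult_right int)
  also have "\<dots> = \<epsilon> * t + L * integral {0..t} (\<lambda>s. norm (y s - z s))"
    using t by (subst Henstock_Kurzweil_Integration.integral_add)
      (auto intro!: integrable_on_mult_right int)
  also have "\<dots> \<le> \<epsilon> * U + L * integral {0..t} (\<lambda>s. norm (y s - z s))"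
    using t \<open>\<epsilon> \<ge> 0\<close> by (simp add: mult_left_mono)
  finally show "norm (y t - z t) \<le> \<epsilon> * U + L * integral {0..t} (\<lambda>s. norm (y s - z s))" .
qed (use assms in auto)

section \<open>The profile as a function of the value, by shooting\<close>

text \<open>
  Substituting \<open>G = a W\<close> and \<open>\<mu> = 2 / a\<^sup>2\<close> gives \<open>W'' = - \<mu> k / W\<close> with data \<open>W 0 = V\<close>, \<open>W' 0 = 1\<close>
  that do not depend on the parameter, and \<open>\<mu>\<close> is found by shooting for \<open>W' U = 0\<close>. Replacing \<open>W\<close> by
  \<open>max W V\<close> in the denominator makes the equation globally Lipschitz; it changes nothing for
  the final \<open>\<mu>\<close>, because \<open>W\<close> is concave and hence increasing up to \<open>U\<close>.
\<close>

lemma profile_exists: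
  fixes k :: "real \<Rightarrow> real"
  assumes "U > 0" and "V > 0" and kc: "continuous_on {0..U} k"
    and kpos: "\<And>s. 0 < s \<Longrightarrow> s \<le> U \<Longrightarrow> k s > 0" and "k 0 \<ge> 0"
  obtains a G H where "a > 0"
    "continuous_on {0..U} G" "continuous_on {0..U} H"
    "\<And>u. u \<in> {0..U} \<Longrightarrow> G u > 0"
    "\<And>u. u \<in> {0<..<U} \<Longrightarrow> (G has_real_derivative H u) (at u)"
    "\<And>u. u \<in> {0<..<U} \<Longrightarrow> (H has_real_derivative - (2 * k u / G u)) (at u)"
    "G 0 = a * V" "H 0 = a" "H U = 0"
proof -
  have k0: "k t \<ge> 0" if "t \<in> {0..U}" for t
    using kpos[of t] \<open>k 0 \<ge> 0\<close> that by (cases "t = 0") auto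
  obtain K where K: "\<And>t. t \<in> {0..U} \<Longrightarrow> k t \<le> K"
  proof -
    have "compact (k ` {0..U})" by (intro compact_continuous_image kc) auto
    then show ?thesis using that compact_imp_bounded bounded_iff
      by (metis abs_le_D1 image_eqI real_norm_def)
  qed
  have "K \<ge> 0" using K[of 0] k0[of 0] \<open>U > 0\<close> by auto
  have at_in: "at t within {0..U} = at t" if "0 < t" "t < U" for t
    using that by (intro at_within_interior) (auto simp: interior_atLeastAtMost_real)
  define I where "I = (\<lambda>t. integral {0..t} k)"
  have dI: "(I has_real_derivative k t) (at t within {0..U})" if "t \<in> {0..U}" for t
    unfolding I_def by (rule integral_has_real_derivative[OF kc that])
  have "I 0 < I U"
  proof (rule DERIV_pos_imp_increasing_open[of 0 U I])
    show "continuous_on {0..U} I" by (rule DERIV_continuous_on[OF dI])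
  qed (use dI kpos \<open>U > 0\<close> at_in in \<open>auto, metis atLeastAtMost_iff less_imp_le\<close>)
  then have "I U > 0" by (simp add: I_def)
  \<comment> \<open>Chosen so that \<open>M * I U / (V + U) = 1\<close>. As \<open>W\<close> stays
    below \<open>V + U\<close>, the slope for \<open>\<mu> = M\<close> drops from 1 by at least this
    amount, hence to at most 0 at \<open>U\<close>.\<close>
  define M where "M = (V + U) / I U"
  have "M > 0" using \<open>U > 0\<close> \<open>V > 0\<close> \<open>I U > 0\<close> by (simp add: M_def)
  \<comment> \<open>The 1 comes from the first component of the system; the other term bounds the
    Lipschitz constant of \<open>\<mu> * k t / max w V\<close> in \<open>w\<close>, whose
    denominators are at least \<open>V\<close>.\<close>
  define L where "L = 1 + M * K / V\<^sup>2"
  have "L \<ge> 0" using \<open>M > 0\<close> \<open>K \<ge> 0\<close> by (simp add: L_def)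
  define F where "F = (\<lambda>\<mu> t p. (snd p, - (\<mu> * k t / max (fst p) V)) :: real \<times> real)"
  \<comment> \<open>One estimate for two uses: \<open>\<mu> = \<nu>\<close> gives the Lipschitz
    condition of \<open>picard_lindelof\<close>, and distinct parameters give the perturbation bound
    of \<open>ode_dependence\<close>.\<close>
  have Fdiff: "norm (F \<mu> t p - F \<nu> t q) \<le> K / V * \<bar>\<mu> - \<nu>\<bar> + L * norm (p - q)"
    if \<mu>: "\<mu> \<in> {0..M}" and t: "t \<in> {0..U}" for \<mu> \<nu> t p q
  proof -
    define m n where "m = max (fst p) V" and "n = max (fst q) V"
    have mn: "m \<ge> V" "n \<ge> V" "\<bar>n - m\<bar> \<le> \<bar>fst p - fst q\<bar>" by (auto simp: m_def n_def)
    have "\<mu> * k t / m - \<nu> * k t / n = k t / n * (\<mu> - \<nu>) + \<mu> * k t / (m * n) * (n - m)"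
      using mn \<open>V > 0\<close> by (simp add: field_simps)
    also have "\<bar>\<dots>\<bar> \<le> k t / n * \<bar>\<mu> - \<nu>\<bar> + \<mu> * k t / (m * n) * \<bar>n - m\<bar>"
      using mn \<open>V > 0\<close> k0[OF t] \<mu> by (intro order.trans[OF abs_triangle_ineq]) (simp add: abs_mult)
    also have "\<dots> \<le> K / V * \<bar>\<mu> - \<nu>\<bar> + M * K / V\<^sup>2 * norm (p - q)"
    proof (intro add_mono mult_mono frac_le)
      show "V\<^sup>2 \<le> m * n" unfolding power2_eq_square using mn \<open>V > 0\<close> by (intro mult_mono) auto
      show "\<bar>n - m\<bar> \<le> norm (p - q)"
        using mn(3) norm_fst_le[of "fst (p - q)" "snd (p - q)", unfolded prod.collapse] by (simp add: fst_diff)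
    qed (use mn \<open>V > 0\<close> k0[OF t] K[OF t] \<mu> \<open>K \<ge> 0\<close> \<open>M > 0\<close> in auto)
    finally have *: "\<bar>\<mu> * k t / m - \<nu> * k t / n\<bar> \<le> K / V * \<bar>\<mu> - \<nu>\<bar> + M * K / V\<^sup>2 * norm (p - q)" .
    have "norm (F \<mu> t p - F \<nu> t q) \<le> \<bar>snd p - snd q\<bar> + \<bar>\<mu> * k t / m - \<nu> * k t / n\<bar>"
      using norm_Pair_le[of "snd p - snd q" "- (\<mu> * k t / m) - - (\<nu> * k t / n)"]
      by (simp add: F_def m_def n_def abs_minus_commute)
    also have "\<bar>snd p - snd q\<bar> \<le> norm (p - q)"
      using norm_snd_le[of "snd (p - q)" "fst (p - q)", unfolded prod.collapse] by (simp add: snd_diff)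
    finally show ?thesis using * by (simp add: L_def algebra_simps)
  qed
  have "\<exists>y. y 0 = (V, 1) \<and>
      (\<forall>t\<in>{0..U}. (y has_vector_derivative F \<mu> t (y t)) (at t within {0..U}))"
    if \<mu>: "\<mu> \<in> {0..M}" for \<mu>
  proof (rule picard_lindelof)
    show "continuous_on ({0..U} \<times> UNIV) (\<lambda>(t, x). F \<mu> t x)"
      unfolding F_def case_prod_unfold
      by (intro continuous_intros continuous_on_compose2[OF kc]) (use \<open>V > 0\<close> in auto)
    show "norm (F \<mu> t x - F \<mu> t y) \<le> L * norm (x - y)" if "t \<in> {0..U}" for t x y
      using Fdiff[OF \<mu> that, of x \<mu> y] by simp
  qed (use \<open>U > 0\<close> \<open>L \<ge> 0\<close> in auto)
  then obtain Y where Y0: "\<And>\<mu>. \<mu> \<in> {0..M} \<Longrightarrow> Y \<mu> 0 = (V, 1)"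
    and dY: "\<And>\<mu> t. \<mu> \<in> {0..M} \<Longrightarrow> t \<in> {0..U} \<Longrightarrow>
      (Y \<mu> has_vector_derivative F \<mu> t (Y \<mu> t)) (at t within {0..U})"
    by metis
  define W Z where "W = (\<lambda>\<mu> t. fst (Y \<mu> t))" and "Z = (\<lambda>\<mu> t. snd (Y \<mu> t))"
  have WZ0: "W \<mu> 0 = V" "Z \<mu> 0 = 1" if "\<mu> \<in> {0..M}" for \<mu>
    using Y0[OF that] by (auto simp: W_def Z_def)
  have dW: "(W \<mu> has_real_derivative Z \<mu> t) (at t within {0..U})"
    and dZ: "(Z \<mu> has_real_derivative - (\<mu> * k t / max (W \<mu> t) V)) (at t within {0..U})"
    if "\<mu> \<in> {0..M}" "t \<in> {0..U}" for \<mu> t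
    using bounded_linear.has_vector_derivative[OF bounded_linear_fst dY[OF that]]
      bounded_linear.has_vector_derivative[OF bounded_linear_snd dY[OF that]]
    by (simp_all add: W_def Z_def F_def has_real_derivative_iff_has_vector_derivative)
  have cW: "continuous_on {0..U} (W \<mu>)" and cZ: "continuous_on {0..U} (Z \<mu>)"
    if "\<mu> \<in> {0..M}" for \<mu>
    by (rule DERIV_continuous_on[OF dW[OF that]] DERIV_continuous_on[OF dZ[OF that]]; assumption)+
  have Zmono: "Z \<mu> t \<le> Z \<mu> s" if \<mu>: "\<mu> \<in> {0..M}" and st: "0 \<le> s" "s \<le> t" "t \<le> U" for \<mu> s t
  proof (rule DERIV_nonpos_imp_decreasing_open[of s t "Z \<mu>"])
    show "continuous_on {s..t} (Z \<mu>)" by (rule continuous_on_subset[OF cZ[OF \<mu>]]) (use st in auto)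
    fix x assume x: "s < x" "x < t"
    have "- (\<mu> * k x / max (W \<mu> x) V) \<le> 0"
      using \<mu> k0[of x] x st \<open>V > 0\<close> by (auto intro!: divide_nonneg_pos)
    then show "\<exists>y. (Z \<mu> has_real_derivative y) (at x) \<and> y \<le> 0"
      using dZ[OF \<mu>, of x] at_in[of x] x st by auto
  qed (use st in auto)
  \<comment> \<open>The slope starts at 1 and does not increase, so \<open>W\<close> grows at most
    as fast as the identity.\<close>
  have Wle: "W \<mu> t \<le> V + U" if \<mu>: "\<mu> \<in> {0..M}" and t: "t \<in> {0..U}" for \<mu> t
  proof -
    have "W \<mu> t - t \<le> W \<mu> 0 - 0"
    proof (rule DERIV_nonpos_imp_decreasing_open[of 0 t "\<lambda>t. W \<mu> t - t"])
      show "continuous_on {0..t} (\<lambda>t. W \<mu> t - t)"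
        by (intro continuous_intros continuous_on_subset[OF cW[OF \<mu>]]) (use t in auto)
      fix x assume x: "0 < x" "x < t"
      have "((\<lambda>t. W \<mu> t - t) has_real_derivative Z \<mu> x - 1) (at x)"
        using dW[OF \<mu>, of x] at_in[of x] x t by (auto intro!: derivative_eq_intros)
      moreover have "Z \<mu> x - 1 \<le> 0" using Zmono[OF \<mu>, of 0 x] WZ0[OF \<mu>] x t by auto
      ultimately show "\<exists>y. ((\<lambda>t. W \<mu> t - t) has_real_derivative y) (at x) \<and> y \<le> 0" by blast
    qed (use t in auto)
    then show ?thesis using WZ0[OF \<mu>] t by auto
  qed
  have "Z M U \<le> 0"
  proof -
    have M: "M \<in> {0..M}" using \<open>M > 0\<close> by auto
    let ?h = "\<lambda>t. Z M t + M / (V + U) * I t"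
    have "?h U \<le> ?h 0"
    proof (rule DERIV_nonpos_imp_decreasing_open[of 0 U ?h])
      show "continuous_on {0..U} ?h"
        by (intro continuous_intros cZ M DERIV_continuous_on[OF dI])
      fix x assume x: "0 < x" "x < U"
      have "(?h has_real_derivative (M / (V + U) * k x - (M * k x / max (W M x) V))) (at x)"
        using dZ[OF M, of x] dI[of x] at_in[of x] x \<open>U > 0\<close> \<open>V > 0\<close>
        by (auto intro!: derivative_eq_intros)
      moreover have "M * k x / (V + U) \<le> M * k x / max (W M x) V"
        using Wle[OF M, of x] x \<open>M > 0\<close> k0[of x] \<open>V > 0\<close> by (intro divide_left_mono) auto
      ultimately show "\<exists>y. (?h has_real_derivative y) (at x) \<and> y \<le> 0" by fastforce
    qed (use \<open>U > 0\<close> in auto)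
    then show ?thesis using WZ0[OF M] \<open>I U > 0\<close> \<open>U > 0\<close> \<open>V > 0\<close> by (simp add: M_def I_def)
  qed
  \<comment> \<open>At parameter 0 the slope keeps its initial value 1. This is the other end of the
    shooting interval, and it also shows that the zero found below is not
    \<open>\<mu> = 0\<close>.\<close>
  have Z0: "Z 0 U \<ge> 1"
  proof -
    have M: "0 \<in> {0..M}" using \<open>M > 0\<close> by auto
    have "Z 0 0 \<le> Z 0 U"
    proof (rule DERIV_nonneg_imp_increasing_open[of 0 U "Z 0"])
      fix x assume "0 < x" "x < U"
      then show "\<exists>y. (Z 0 has_real_derivative y) (at x) \<and> 0 \<le> y"
        using dZ[OF M, of x] at_in[of x] by auto
    qed (use \<open>U > 0\<close> cZ[OF M] in auto)
    then show ?thesis using WZ0[OF M] by simp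
  qed
  have "continuous_on {0..M} (\<lambda>\<mu>. Z \<mu> U)"
  proof (rule lipschitz_on_continuous_on, rule lipschitz_onI)
    fix \<mu> \<nu> assume \<mu>\<nu>: "\<mu> \<in> {0..M}" "\<nu> \<in> {0..M}"
    have "norm (Y \<mu> U - Y \<nu> U) \<le> K / V * \<bar>\<mu> - \<nu>\<bar> * U * exp (L * U)"
      by (rule ode_dependence[where y' = "\<lambda>t. F \<mu> t (Y \<mu> t)" and z' = "\<lambda>t. F \<nu> t (Y \<nu> t)"])
        (use dY \<mu>\<nu> Y0 Fdiff \<open>U > 0\<close> \<open>V > 0\<close> \<open>L \<ge> 0\<close> \<open>K \<ge> 0\<close> in auto)
    moreover have "dist (Z \<mu> U) (Z \<nu> U) \<le> norm (Y \<mu> U - Y \<nu> U)"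
      using norm_snd_le[of "snd (Y \<mu> U - Y \<nu> U)" "fst (Y \<mu> U - Y \<nu> U)", unfolded prod.collapse] by (simp add: Z_def dist_norm snd_diff)
    ultimately show "dist (Z \<mu> U) (Z \<nu> U) \<le> K / V * U * exp (L * U) * dist \<mu> \<nu>"
      by (simp add: dist_real_def mult_ac)
  qed (use \<open>U > 0\<close> \<open>V > 0\<close> \<open>K \<ge> 0\<close> in auto)
  then obtain \<mu> where \<mu>: "\<mu> \<in> {0..M}" and ZU: "Z \<mu> U = 0"
    using IVT2'[of "\<lambda>\<mu>. Z \<mu> U" M 0 0] \<open>Z M U \<le> 0\<close> Z0 \<open>M > 0\<close> by auto
  have "\<mu> > 0" using \<mu> ZU Z0 by (cases "\<mu> = 0") auto
  have WV: "W \<mu> t \<ge> V" if t: "t \<in> {0..U}" for t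
  proof -
    have "W \<mu> 0 \<le> W \<mu> t"
    proof (rule DERIV_nonneg_imp_increasing_open[of 0 t "W \<mu>"])
      show "continuous_on {0..t} (W \<mu>)" by (rule continuous_on_subset[OF cW[OF \<mu>]]) (use t in auto)
      fix x assume x: "0 < x" "x < t"
      then show "\<exists>y. (W \<mu> has_real_derivative y) (at x) \<and> 0 \<le> y"
        using dW[OF \<mu>, of x] at_in[of x] t Zmono[OF \<mu>, of x U] ZU by auto
    qed (use t in auto)
    then show ?thesis using WZ0[OF \<mu>] by simp
  qed
  define a where "a = sqrt (2 / \<mu>)"
  have a: "a > 0" "a * a * \<mu> = 2" using \<open>\<mu> > 0\<close> by (auto simp: a_def)
  show ?thesis
  proof (rule that[of a "\<lambda>t. a * W \<mu> t" "\<lambda>t. a * Z \<mu> t"])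
    fix u assume u: "u \<in> {0<..<U}"
    show "((\<lambda>t. a * W \<mu> t) has_real_derivative a * Z \<mu> u) (at u)"
      using dW[OF \<mu>, of u] at_in[of u] u by (auto intro!: derivative_eq_intros)
    have "W \<mu> u > 0" and mx: "max (W \<mu> u) V = W \<mu> u" using WV[of u] u \<open>V > 0\<close> by auto
    \<comment> \<open>Since \<open>a * a * \<mu> = 2\<close>, scaling \<open>W\<close> by
      \<open>a\<close> replaces the coefficient \<open>\<mu>\<close> by 2.\<close>
    then have "a * - (\<mu> * k u / W \<mu> u) = - (a * a * \<mu> * k u / (a * W \<mu> u))"
      using a(1) by simp
    also have "\<dots> = - (2 * k u / (a * W \<mu> u))" by (simp only: a(2))
    finally show "((\<lambda>t. a * Z \<mu> t) has_real_derivative - (2 * k u / (a * W \<mu> u))) (at u)"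
      using DERIV_cmult[OF dZ[OF \<mu>, of u], of a] at_in[of u] u mx by (simp del: mult_minus_right)
  next
    show "a * W \<mu> u > 0" if "u \<in> {0..U}" for u
      using WV[OF that] \<open>V > 0\<close> a(1) by (intro mult_pos_pos) auto
  qed (use a ZU WZ0[OF \<mu>] cW[OF \<mu>] cZ[OF \<mu>] in \<open>auto intro!: continuous_intros\<close>)
qed

section \<open>Comparison of an arbitrary solution with the profile\<close>

text \<open>Once \<open>g\<close> is known to decrease, its flux can be compared with
  \<open>G\<close> and its position with \<open>H\<close> at the same value of \<open>g\<close>. A
  product of the two errors is squeezed to zero, which fixes the free boundary and makes
  \<open>g\<close> invert \<open>H\<close>.\<close>

lemma fb_solution_profile:
  fixes \<phi> g G H :: "real \<Rightarrow> real"
  assumes kpos: "\<And>s. s > 0 \<Longrightarrow> deriv \<phi> s > 0" and "V > 0"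
    and cG: "continuous_on {0..U} G" and cH: "continuous_on {0..U} H"
    and Gpos: "\<And>u. u \<in> {0..U} \<Longrightarrow> G u > 0"
    and dG: "\<And>u. u \<in> {0<..<U} \<Longrightarrow> (G has_real_derivative H u) (at u)"
    and dH: "\<And>u. u \<in> {0<..<U} \<Longrightarrow> (H has_real_derivative - (2 * deriv \<phi> u / G u)) (at u)"
    and bc: "G 0 = a * V" "H 0 = a" "H U = 0"
    and sol: "fb_solution \<phi> U V g b"
  shows "b = a \<and> (\<forall>\<eta>\<in>{0<..<a}. g \<eta> \<in> {0<..<U} \<and> H (g \<eta>) = \<eta>)"
proof -
  define q where "q = (\<lambda>x. deriv \<phi> (g x) * deriv g x)"
  from sol have b: "b > 0" and cg: "continuous_on {0..<b} g"
    and gpos: "\<And>\<eta>. \<eta> \<in> {0..<b} \<Longrightarrow> g \<eta> > 0" and g0: "g 0 = U"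
    and dg: "\<And>\<eta>. \<eta> \<in> {0<..<b} \<Longrightarrow> (g has_real_derivative deriv g \<eta>) (at \<eta>)"
    and dq: "\<And>\<eta>. \<eta> \<in> {0<..<b} \<Longrightarrow> (q has_real_derivative - (1/2) * \<eta> * deriv g \<eta>) (at \<eta>)"
    and glim: "(g \<longlongrightarrow> 0) (at_left b)" and qlim: "(q \<longlongrightarrow> - (b * V / 2)) (at_left b)"
    unfolding fb_solution_def C2_on_def q_def
    by (auto simp: DERIV_deriv_iff_real_differentiable)
  have left: "\<forall>\<^sub>F x in at_left b. x \<in> {0<..<b}"
    using b eventually_at_left_real by blast
  have q_sign: "q x < 0 \<longleftrightarrow> deriv g x < 0" if "x \<in> {0<..<b}" for x
    using kpos[of "g x"] gpos[of x] that by (auto simp: q_def mult_less_0_iff)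
  \<comment> \<open>Right of a last point with \<open>q \<ge> 0\<close>, the equation makes \<open>q\<close> increase, so \<open>q\<close> could not
     reach its negative limit.\<close>
  have qneg: "q x < 0" if x: "x \<in> {0<..<b}" for x
  proof (rule ccontr)
    assume "\<not> q x < 0"
    have "\<forall>\<^sub>F y in at_left b. q y < 0"
      using order_tendstoD(2)[OF qlim, of 0] b \<open>V > 0\<close> by simp
    moreover have "\<forall>\<^sub>F y in at_left b. y \<in> {x<..<b}"
      using x eventually_at_left_real by auto
    ultimately have "\<exists>y. q y < 0 \<and> y \<in> {x<..<b}"
      using eventually_happens[OF eventually_conj] by fastforce
    then obtain y where y: "q y < 0" "x < y" "y < b" by auto
    have cq: "continuous_on {x..y} q"
      using x y by (intro DERIV_atLeastAtMost_imp_continuous_on) (force intro!: exI dq)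
    define S where "S = {x..y} \<inter> q -` {0..}"
    have "closed S" unfolding S_def
      by (rule continuous_closed_preimage[OF cq closed_atLeastAtMost closed_atLeast])
    then have "compact S" by (auto simp: compact_eq_bounded_closed S_def)
    moreover have "x \<in> S" using \<open>\<not> q x < 0\<close> y by (auto simp: S_def)
    ultimately obtain e where e: "e \<in> S" "\<And>t. t \<in> S \<Longrightarrow> t \<le> e"
      using compact_attains_sup[of S] by auto
    have "e < y" "x \<le> e" "q e \<ge> 0" using e(1) y by (auto simp: S_def less_le)
    have "q e < q y"
    proof (rule DERIV_pos_imp_increasing_open[OF \<open>e < y\<close>])
      show "continuous_on {e..y} q" by (rule continuous_on_subset[OF cq]) (use \<open>x \<le> e\<close> in auto)
      fix t assume t: "e < t" "t < y"
      then have tb: "t \<in> {0<..<b}" using x y \<open>x \<le> e\<close> by auto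
      have "q t < 0" using e(2)[of t] t \<open>x \<le> e\<close> by (force simp: S_def not_less[symmetric])
      then have "- (1/2) * t * deriv g t > 0"
        using q_sign[OF tb] tb by (auto simp: mult_pos_neg)
      then show "\<exists>z. (q has_real_derivative z) (at t) \<and> z > 0" using dq[OF tb] by blast
    qed
    then show False using y \<open>q e \<ge> 0\<close> by simp
  qed
  then have g'neg: "deriv g x < 0" if "x \<in> {0<..<b}" for x using q_sign that by blast
  have gdec: "g y < g x" if "0 \<le> x" "x < y" "y < b" for x y
  proof (rule DERIV_neg_imp_decreasing_open[OF \<open>x < y\<close>])
    show "continuous_on {x..y} g" by (rule continuous_on_subset[OF cg]) (use that in auto)
    show "\<exists>z. (g has_real_derivative z) (at t) \<and> z < 0" if "x < t" "t < y" for t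
      using dg[of t] g'neg[of t] that \<open>0 \<le> x\<close> \<open>y < b\<close> by auto
  qed
  \<comment> \<open>Strict decrease keeps the values off both endpoints, so \<open>g\<close> may be
    composed with \<open>G\<close> and \<open>H\<close>, whose derivatives are given on the open
    interval.\<close>
  have gU: "g x \<in> {0<..<U}" if "x \<in> {0<..<b}" for x
    using gdec[of 0 x] gpos[of x] g0 that by auto
  then have gU': "g x \<in> {0..U}" if "x \<in> {0<..<b}" for x
    using that by (meson greaterThanLessThan_subseteq_atLeastAtMost_iff order_refl subsetD)
  \<comment> \<open>\<open>D\<close> and \<open>d\<close> compare \<open>g\<close> with the profile; both vanish identically exactly when \<open>g\<close> inverts \<open>H\<close>.
     They satisfy \<open>D' = d g'\<close> and \<open>d' = - D / G(g)\<close>, so \<open>D d\<close> is decreasing, while its limits are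
     \<open>0\<close> at \<open>0\<close> and \<open>(a - b)\<^sup>2 V \<ge> 0\<close> at \<open>b\<close>.\<close>
  define D d where "D = (\<lambda>x. G (g x) + 2 * q x)" and "d = (\<lambda>x. H (g x) - x)"
  have dD: "(D has_real_derivative d x * deriv g x) (at x)" if x: "x \<in> {0<..<b}" for x
    unfolding D_def d_def
    by (rule derivative_eq_intros DERIV_chain2[OF dG[OF gU[OF x]] dg[OF x]] dq[OF x] refl)+
      (simp add: algebra_simps)
  have dd: "(d has_real_derivative - D x / G (g x)) (at x)" if x: "x \<in> {0<..<b}" for x
    unfolding D_def d_def
    by (rule derivative_eq_intros DERIV_chain2[OF dH[OF gU[OF x]] dg[OF x]] refl)+
      (use Gpos[OF gU'[OF x]] in \<open>simp add: field_simps q_def\<close>)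
  define E where "E = (\<lambda>x. D x * d x)"
  have dE: "(E has_real_derivative (d x)\<^sup>2 * deriv g x - (D x)\<^sup>2 / G (g x)) (at x)"
    if x: "x \<in> {0<..<b}" for x
    unfolding E_def using DERIV_mult[OF dD[OF x] dd[OF x]]
    by (simp add: power2_eq_square algebra_simps)
  have Edec: "E y \<le> E x" if xy: "0 < x" "x \<le> y" "y < b" for x y
  proof (rule DERIV_nonpos_imp_nonincreasing[OF \<open>x \<le> y\<close>])
    fix t assume "x \<le> t" "t \<le> y"
    then have t: "t \<in> {0<..<b}" using xy by auto
    have "(d t)\<^sup>2 * deriv g t \<le> 0" using g'neg[OF t] by (simp add: mult_nonneg_nonpos)
    moreover have "(D t)\<^sup>2 / G (g t) \<ge> 0" using Gpos[OF gU'[OF t]] by simp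
    ultimately show "\<exists>z. (E has_real_derivative z) (at t) \<and> z \<le> 0"
      using dE[OF t] by force
  qed
  have U: "U > 0" using gpos[of 0] b g0 by simp
  have gl: "\<forall>\<^sub>F x in at_left b. g x \<in> {0..U}"
    using left by eventually_elim (rule gU')
  have "(D \<longlongrightarrow> G 0 + 2 * - (b * V / 2)) (at_left b)" unfolding D_def
    by (intro tendsto_intros qlim continuous_on_tendsto_compose[OF cG glim _ gl]) (use U in auto)
  moreover have "(d \<longlongrightarrow> H 0 - b) (at_left b)" unfolding d_def
    by (intro tendsto_intros continuous_on_tendsto_compose[OF cH glim _ gl]) (use U in auto)
  ultimately have Elim: "(E \<longlongrightarrow> (a * V - b * V) * (a - b)) (at_left b)"
    unfolding E_def using tendsto_mult bc by fastforce
  have Elow: "(a - b)\<^sup>2 * V \<le> E x" if x: "x \<in> {0<..<b}" for x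
  proof -
    have "\<forall>\<^sub>F y in at_left b. y \<in> {x<..<b}" using x eventually_at_left_real by auto
    then have "\<forall>\<^sub>F y in at_left b. E y \<le> E x"
      by eventually_elim (use x in \<open>auto intro: Edec\<close>)
    then have "(a * V - b * V) * (a - b) \<le> E x"
      by (rule tendsto_upperbound[OF Elim]) simp
    then show ?thesis by (simp add: power2_eq_square algebra_simps)
  qed
  have right: "\<forall>\<^sub>F x in at_right 0. x \<in> {0<..<b/2}"
    using b eventually_at_right_real[of 0 "b/2"] by simp
  \<comment> \<open>A solution has no prescribed flux at 0, so \<open>D\<close> is only shown to be
    bounded there; this suffices because \<open>d\<close> tends to \<open>H U = 0\<close>.\<close>
  have "(E \<longlongrightarrow> 0) (at_right 0)"
  proof -
    have "continuous_on {0..b/2} g" by (rule continuous_on_subset[OF cg]) (use b in auto)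
    then have "(g \<longlongrightarrow> g 0) (at 0 within {0..b/2})"
      using b by (auto simp: continuous_on_def)
    then have gr: "(g \<longlongrightarrow> U) (at_right 0)"
      using b by (simp add: g0 at_within_Icc_at_right)
    have "\<forall>\<^sub>F x in at_right 0. g x \<in> {0..U}"
      using right by eventually_elim (rule gU', use b in auto)
    then have "(d \<longlongrightarrow> H U - 0) (at_right 0)" unfolding d_def
      by (intro tendsto_intros continuous_on_tendsto_compose[OF cH gr]) (use U in auto)
    then have d0: "(d \<longlongrightarrow> 0) (at_right 0)" using bc by simp
    have "bounded (G ` {0..U})"
      by (intro compact_imp_bounded compact_continuous_image cG) auto
    then obtain B where B: "\<And>u. u \<in> {0..U} \<Longrightarrow> \<bar>G u\<bar> \<le> B"
      unfolding bounded_iff by (metis imageI real_norm_def)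
    \<comment> \<open>The second term serves to bound \<open>- 2 * q\<close> on the left half:
      \<open>- 2 * q t - b * g t\<close> has derivative \<open>(t - b) * deriv g t\<close>, which is
      nonnegative, so its value at \<open>b/2\<close> dominates. The values of \<open>g\<close> lie
      between 0 and \<open>U\<close>.\<close>
    define C where "C = B + \<bar>b * U - 2 * q (b/2)\<bar>"
    have DC: "\<bar>D x\<bar> \<le> C" if x: "x \<in> {0<..<b/2}" for x
    proof -
      have xb: "x \<in> {0<..<b}" and bb: "b/2 \<in> {0<..<b}" using x b by auto
      have "- 2 * q x - b * g x \<le> - 2 * q (b/2) - b * g (b/2)"
      proof (rule DERIV_nonneg_imp_nondecreasing[of x "b/2" "\<lambda>t. - 2 * q t - b * g t"])
        show "x \<le> b/2" using x by auto
        fix t assume "x \<le> t" "t \<le> b/2"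
        then have t: "t \<in> {0<..<b}" using x b by auto
        have "((\<lambda>t. - 2 * q t - b * g t) has_real_derivative (t - b) * deriv g t) (at t)"
          by (rule derivative_eq_intros dq[OF t] dg[OF t] refl)+ (simp add: algebra_simps)
        moreover have "(t - b) * deriv g t \<ge> 0"
          using t g'neg[OF t] by (intro mult_nonpos_nonpos) auto
        ultimately show "\<exists>y. ((\<lambda>t. - 2 * q t - b * g t) has_real_derivative y) (at t) \<and> 0 \<le> y"
          by blast
      qed
      moreover have "b * g x \<le> b * U" "b * g (b/2) \<ge> 0"
        using gU'[OF xb] gU'[OF bb] b by (auto intro!: mult_left_mono mult_nonneg_nonneg)
      ultimately have "- 2 * q x \<le> b * U - 2 * q (b/2)" by simp
      then show ?thesis using qneg[OF xb] B[OF gU'[OF xb]] unfolding D_def C_def by simp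
    qed
    show ?thesis
    proof (rule Lim_null_comparison)
      show "\<forall>\<^sub>F x in at_right 0. norm (E x) \<le> C * \<bar>d x\<bar>"
        using right by eventually_elim (use DC in \<open>auto simp: E_def abs_mult intro!: mult_right_mono\<close>)
      show "((\<lambda>x. C * \<bar>d x\<bar>) \<longlongrightarrow> 0) (at_right 0)"
        using tendsto_mult_right_zero[OF tendsto_rabs_zero[OF d0]] .
    qed
  qed
  then have Eup: "E x \<le> 0" if x: "x \<in> {0<..<b}" for x
  proof (rule tendsto_lowerbound)
    have "\<forall>\<^sub>F y in at_right 0. y \<in> {0<..<x}" using x eventually_at_right_real[of 0 x] by auto
    then show "\<forall>\<^sub>F y in at_right 0. E x \<le> E y"
      by eventually_elim (use x in \<open>auto intro: Edec\<close>)
  qed simp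
  have bb: "b/2 \<in> {0<..<b}" using b by simp
  \<comment> \<open>The lower bound from the end \<open>b\<close> meets the upper bound 0 from the
    end 0; this forces \<open>a = b\<close>, and then \<open>E\<close> vanishes throughout.\<close>
  have "(a - b)\<^sup>2 * V \<le> 0" using Elow[OF bb] Eup[OF bb] by simp
  then have ab: "a = b" using \<open>V > 0\<close> by (simp add: mult_le_0_iff)
  have E0: "E x = 0" if "x \<in> {0<..<b}" for x
    using Elow[OF that] Eup[OF that] ab by simp
  have "d x = 0" if x: "x \<in> {0<..<b}" for x
  proof (rule ccontr)
    assume "d x \<noteq> 0"
    \<comment> \<open>The derivative of \<open>E\<close> is a sum of two nonpositive terms, so both
      vanish when it is 0; \<open>d x \<noteq> 0\<close> would make the first one strictly
      negative.\<close>
    have "(E has_real_derivative 0) (at x)"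
      by (rule has_field_derivative_transform_within_open[OF DERIV_const[of 0], of "{0<..<b}"])
        (use x E0 in auto)
    then have "(d x)\<^sup>2 * deriv g x - (D x)\<^sup>2 / G (g x) = 0" using dE[OF x] DERIV_unique by blast
    moreover have "(d x)\<^sup>2 * deriv g x < 0" 
      using \<open>d x \<noteq> 0\<close> g'neg[OF x] by (simp add: mult_pos_neg)
    moreover have "(D x)\<^sup>2 / G (g x) \<ge> 0" using Gpos[OF gU'[OF x]] by simp
    ultimately show False by simp
  qed
  then show ?thesis using ab gU by (auto simp: d_def)
qed

section \<open>Construction of a solution from the profile\<close>

text \<open>The inverse \<open>f\<close> of the decreasing function \<open>H\<close> has slope
  \<open>1 / H'(f)\<close>, so its flux is \<open>- G(f) / 2\<close>. Because \<open>G' = H\<close>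
  and \<open>H(f(x)) = x\<close>, differentiating this flux gives the equation, and
  \<open>G 0 = a * V\<close> gives the flux condition at \<open>a\<close>.\<close>

lemma fb_solution_of_profile:
  fixes \<phi> G H :: "real \<Rightarrow> real"
  assumes C2: "C2_on \<phi> UNIV" and kpos: "\<And>s. s > 0 \<Longrightarrow> deriv \<phi> s > 0"
    and "U > 0" and "a > 0"
    and cG: "continuous_on {0..U} G" and cH: "continuous_on {0..U} H"
    and Gpos: "\<And>u. u \<in> {0..U} \<Longrightarrow> G u > 0"
    and dG: "\<And>u. u \<in> {0<..<U} \<Longrightarrow> (G has_real_derivative H u) (at u)"
    and dH: "\<And>u. u \<in> {0<..<U} \<Longrightarrow> (H has_real_derivative - (2 * deriv \<phi> u / G u)) (at u)"
    and bc: "G 0 = a * V" "H 0 = a" "H U = 0"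
  shows "\<exists>f. fb_solution \<phi> U V f a"
proof -
  have Hdec: "H v < H u" if uv: "0 \<le> u" "u < v" "v \<le> U" for u v
  proof (rule DERIV_neg_imp_decreasing_open[OF \<open>u < v\<close>])
    show "continuous_on {u..v} H" by (rule continuous_on_subset[OF cH]) (use uv in auto)
    fix t assume t: "u < t" "t < v"
    then have "- (2 * deriv \<phi> t / G t) < 0"
      using kpos[of t] Gpos[of t] uv by simp
    then show "\<exists>z. (H has_real_derivative z) (at t) \<and> z < 0" using dH[of t] t uv by auto
  qed
  have inj: "inj_on H {0..U}"
    by (rule linorder_inj_onI) (use Hdec in force)+
  define e where "e = the_inv_into {0..U} H"
  have eH: "e (H u) = u" if "u \<in> {0..U}" for u
    unfolding e_def by (rule the_inv_into_f_f[OF inj that])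
  have img: "H ` {0..U} = {0..a}"
  proof
    have "H u \<in> {0..a}" if "u \<in> {0..U}" for u
      using Hdec[of 0 u] Hdec[of u U] bc that by (cases "u = 0"; cases "u = U") auto
    then show "H ` {0..U} \<subseteq> {0..a}" by blast
    show "{0..a} \<subseteq> H ` {0..U}"
    proof
      fix y assume "y \<in> {0..a}"
      then show "y \<in> H ` {0..U}"
        using IVT2'[of H U y 0] bc cH \<open>U > 0\<close> by force
    qed
  qed
  have e_in: "e x \<in> {0..U}" and He: "H (e x) = x" if "x \<in> {0..a}" for x
    using that eH unfolding img[symmetric] by auto
  have e_bd: "e 0 = U" "e a = 0" using eH[of U] eH[of 0] bc \<open>U > 0\<close> by auto
  have ce: "continuous_on {0..a} e"
    unfolding img[symmetric] by (rule continuous_on_inv[OF cH]) (use eH in auto)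
  have e_pos: "e x > 0" if "x \<in> {0..<a}" for x
    using e_in[of x] He[of x] that bc by (cases "e x = 0") auto
  have e_int: "e x \<in> {0<..<U}" if "x \<in> {0<..<a}" for x
    using e_pos[of x] e_in[of x] He[of x] that bc by (cases "e x = U") auto
  \<comment> \<open>At \<open>a\<close> this takes the value \<open>- V\<close>, whereas
    \<open>e a = 0\<close>; the left limit of \<open>f\<close> is therefore obtained from the
    continuity of \<open>e\<close>.\<close>
  define f where "f = (\<lambda>x. if x < a then e x else - V)"
  have fe: "f x = e x" if "x < a" for x using that by (simp add: f_def)
  have cf: "continuous_on {0..<a} f"
    by (rule continuous_on_eq[OF continuous_on_subset[OF ce]]) (auto simp: fe)
  define F1 where "F1 = (\<lambda>x. - (G (f x) / (2 * deriv \<phi> (f x))))"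
  have f_int: "f x \<in> {0<..<U}" if "x \<in> {0<..<a}" for x
    using e_int[OF that] fe that by auto
  have nz: "deriv \<phi> (f x) > 0" "G (f x) > 0" if "x \<in> {0<..<a}" for x
    using f_int[OF that] kpos Gpos by auto
  have df: "(f has_real_derivative F1 x) (at x)" if x: "x \<in> {0<..<a}" for x
  proof -
    have "(f has_real_derivative inverse (- (2 * deriv \<phi> (f x) / G (f x)))) (at x)"
    proof (rule has_field_derivative_inverse_basic[where f = H and t = "{0<..<a}"])
      show "(H has_real_derivative - (2 * deriv \<phi> (f x) / G (f x))) (at (f x))"
        by (rule dH[OF f_int[OF x]])
      show "continuous (at x) f"
        using continuous_on_interior[OF cf, of x] x by simp
      show "H (f z) = z" if "z \<in> {0<..<a}" for z using He[of z] fe that by auto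
    qed (use x nz[OF x] in auto)
    then show ?thesis by (simp add: F1_def)
  qed
  have f': "deriv f x = F1 x" if "x \<in> {0<..<a}" for x using df[OF that] by (rule DERIV_imp_deriv)
  have dG': "((\<lambda>x. G (f x)) has_real_derivative x * F1 x) (at x)" if x: "x \<in> {0<..<a}" for x
    using DERIV_chain2[OF dG[OF f_int[OF x]] df[OF x]] He[of x] fe[of x] x by simp
  have dk: "(deriv \<phi> has_real_derivative deriv (deriv \<phi>) u) (at u)" for u
    using C2 by (auto simp: C2_on_def DERIV_deriv_iff_real_differentiable)
  have ck: "continuous_on UNIV (deriv \<phi>)" 
    by (rule DERIV_continuous_on[where D = "deriv (deriv \<phi>)"]) (use dk in simp)
  \<comment> \<open>The quotient rule applied to \<open>F1\<close>. The explicit formula is used to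
    read off continuity of the second derivative, which is where continuity of the second derivative
    of \<open>\<phi>\<close> enters.\<close>
  define F2 where "F2 = (\<lambda>x. - ((x * F1 x * (2 * deriv \<phi> (f x)) -
      G (f x) * (2 * (deriv (deriv \<phi>) (f x) * F1 x))) / (2 * deriv \<phi> (f x) * (2 * deriv \<phi> (f x)))))"
  have dF1: "(F1 has_real_derivative F2 x) (at x)" if x: "x \<in> {0<..<a}" for x
    unfolding F1_def[abs_def] F2_def
    using nz[OF x]
    by (intro DERIV_minus DERIV_divide dG'[OF x, unfolded F1_def] DERIV_cmult
        DERIV_chain2[OF dk df[OF x, unfolded F1_def]]) auto
  have dF1': "(deriv f has_real_derivative F2 x) (at x)" if x: "x \<in> {0<..<a}" for x
    by (rule has_field_derivative_transform_within_open[OF dF1[OF x], of "{0<..<a}"])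
      (use x f' in auto)
  have f'': "deriv (deriv f) x = F2 x" if "x \<in> {0<..<a}" for x
    using dF1'[OF that] by (rule DERIV_imp_deriv)
  have cf': "continuous_on {0<..<a} f" by (rule continuous_on_subset[OF cf]) auto
  have cGf: "continuous_on {0<..<a} (\<lambda>x. G (f x))"
    by (rule continuous_on_compose2[OF cG cf']) (use f_int in force)
  have ckf: "continuous_on {0<..<a} (\<lambda>x. deriv \<phi> (f x))"
    by (rule continuous_on_compose2[OF ck cf']) auto
  have ckf': "continuous_on {0<..<a} (\<lambda>x. deriv (deriv \<phi>) (f x))"
    by (rule continuous_on_compose2[OF _ cf', of UNIV]) (use C2 in \<open>auto simp: C2_on_def\<close>)
  have "continuous_on {0<..<a} F2"
    unfolding F2_def F1_def
    using nz by (intro continuous_intros cGf ckf ckf') (auto simp: less_le)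
  then have "continuous_on {0<..<a} (deriv (deriv f))"
    by (rule continuous_on_eq) (simp add: f'')
  then have C2f: "C2_on f {0<..<a}"
    unfolding C2_on_def using df dF1' by (meson real_differentiable_def)
  \<comment> \<open>The factor \<open>deriv \<phi> (f x)\<close>, which degenerates at the free
    boundary, cancels; what remains has a limit at \<open>a\<close> by continuity of
    \<open>G\<close>.\<close>
  have flux: "deriv \<phi> (f x) * deriv f x = - (G (f x) / 2)" if x: "x \<in> {0<..<a}" for x
    using nz[OF x] by (simp add: f'[OF x] F1_def)
  have flux': "((\<lambda>x. deriv \<phi> (f x) * deriv f x) has_real_derivative - (1/2) * x * deriv f x) (at x)"
    if x: "x \<in> {0<..<a}" for x
  proof (rule has_field_derivative_transform_within_open[of "\<lambda>x. - (G (f x) / 2)" _ _ "{0<..<a}"])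
    show "((\<lambda>x. - (G (f x) / 2)) has_real_derivative - (1/2) * x * deriv f x) (at x)"
      using DERIV_minus[OF DERIV_cdivide[OF dG'[OF x], of 2]] by (simp add: f'[OF x])
  qed (use x flux in auto)
  have left: "\<forall>\<^sub>F x in at_left a. x \<in> {0<..<a}"
    using \<open>a > 0\<close> eventually_at_left_real by blast
  have "(e \<longlongrightarrow> e a) (at a within {0..a})"
    using ce \<open>a > 0\<close> by (auto simp: continuous_on_def)
  then have "(e \<longlongrightarrow> 0) (at_left a)"
    using \<open>a > 0\<close> by (simp add: e_bd at_within_Icc_at_left)
  moreover have "\<forall>\<^sub>F x in at_left a. e x = f x"
    using left by eventually_elim (simp add: fe)
  ultimately have flim: "(f \<longlongrightarrow> 0) (at_left a)"
    using tendsto_cong by force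
  have fl: "\<forall>\<^sub>F x in at_left a. f x \<in> {0..U}"
    using left by eventually_elim (use f_int in force)
  have "((\<lambda>x. - (G (f x) / 2)) \<longlongrightarrow> - (G 0 / 2)) (at_left a)"
    by (intro tendsto_intros continuous_on_tendsto_compose[OF cG flim _ fl]) (use \<open>U > 0\<close> in auto)
  moreover have "\<forall>\<^sub>F x in at_left a. - (G (f x) / 2) = deriv \<phi> (f x) * deriv f x"
    using left by eventually_elim (simp add: flux)
  ultimately have "((\<lambda>x. deriv \<phi> (f x) * deriv f x) \<longlongrightarrow> - (a * V / 2)) (at_left a)"
    using tendsto_cong bc by force
  then have "fb_solution \<phi> U V f a"
    unfolding fb_solution_def
    using \<open>a > 0\<close> cf C2f flux' flim e_pos fe e_bd by (auto simp: f_def)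
  then show ?thesis by blast
qed

section \<open>Existence and uniqueness for the free boundary problem\<close>

theorem theorem4p3:
  fixes \<phi> :: "real \<Rightarrow> real" and U0 V0 :: real
  assumes "C2_on \<phi> UNIV"
    and "strict_mono_on {0..} \<phi>"
    and "strict_mono_on {0..} (deriv \<phi>)"
    and "\<And>s. s > 0 \<Longrightarrow> \<phi> s > 0"
    and "\<phi> 0 = 0" and "deriv \<phi> 0 = 0"
    and "(\<integral>\<^sup>+ s\<in>{0<..1}. ennreal (deriv \<phi> s / s) \<partial>lborel) < \<infinity>"
    and "(\<integral>\<^sup>+ s\<in>{1..}. ennreal (deriv \<phi> s / s) \<partial>lborel) = \<infinity>"
    and "U0 > 0" and "V0 > 0"
  shows "\<exists>f a. fb_solution \<phi> U0 V0 f a \<and>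
           (\<forall>g b. fb_solution \<phi> U0 V0 g b \<longrightarrow>
              b = a \<and> (\<forall>\<eta>\<in>{0..} - {a}. g \<eta> = f \<eta>))"
proof -
  have kpos: "deriv \<phi> s > 0" if "s > 0" for s
    using strict_mono_onD[OF assms(3), of 0 s] that assms(6) by simp
  have "continuous_on {0..U0} (deriv \<phi>)"
    using assms(1) by (intro continuous_at_imp_continuous_on ballI differentiable_imp_continuous_within)
      (auto simp: C2_on_def)
  then obtain a G H where "a > 0"
    and prof: "continuous_on {0..U0} G" "continuous_on {0..U0} H"
    "\<And>u. u \<in> {0..U0} \<Longrightarrow> G u > 0"
    "\<And>u. u \<in> {0<..<U0} \<Longrightarrow> (G has_real_derivative H u) (at u)"
    "\<And>u. u \<in> {0<..<U0} \<Longrightarrow> (H has_real_derivative - (2 * deriv \<phi> u / G u)) (at u)"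
    "G 0 = a * V0" "H 0 = a" "H U0 = 0"
    using profile_exists[OF \<open>U0 > 0\<close> \<open>V0 > 0\<close>, of "deriv \<phi>"] kpos assms(6)
    by (metis order.refl)
  obtain f where f: "fb_solution \<phi> U0 V0 f a"
    using fb_solution_of_profile[OF assms(1) kpos \<open>U0 > 0\<close> \<open>a > 0\<close> prof] by blast
  have profile: "b = a \<and> (\<forall>\<eta>\<in>{0<..<a}. g \<eta> \<in> {0<..<U0} \<and> H (g \<eta>) = \<eta>)"
    if "fb_solution \<phi> U0 V0 g b" for g b
    by (rule fb_solution_profile[OF kpos \<open>V0 > 0\<close> prof that])
  have "b = a \<and> (\<forall>\<eta>\<in>{0..} - {a}. g \<eta> = f \<eta>)" if g: "fb_solution \<phi> U0 V0 g b" for g b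
  proof (intro conjI ballI)
    show ba: "b = a" using profile[OF g] by blast
    \<comment> \<open>Both solutions satisfy \<open>H\<close> of the value equals
      \<open>\<eta>\<close> for the same \<open>H\<close>, so strict monotonicity of
      \<open>H\<close> identifies them on the open interval.\<close>
    have Hdec: "H v < H u" if uv: "u \<in> {0<..<U0}" "v \<in> {0<..<U0}" "u < v" for u v
    proof (rule DERIV_neg_imp_decreasing[OF \<open>u < v\<close>])
      fix t assume t: "u \<le> t" "t \<le> v"
      then have "- (2 * deriv \<phi> t / G t) < 0"
        using kpos[of t] prof(3)[of t] uv by simp
      then show "\<exists>z. (H has_real_derivative z) (at t) \<and> z < 0" using prof(5)[of t] t uv by auto
    qed
    fix \<eta> assume "\<eta> \<in> {0..} - {a}"
    then consider "\<eta> = 0" | "\<eta> \<in> {0<..<a}" | "\<eta> > a" by force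
    then show "g \<eta> = f \<eta>"
    proof cases
      case 2
      then have "H (g \<eta>) = H (f \<eta>)" "g \<eta> \<in> {0<..<U0}" "f \<eta> \<in> {0<..<U0}"
        using profile[OF g] profile[OF f] by auto
      then show ?thesis using Hdec by (metis less_irrefl linorder_neqE)
    qed (use f g ba in \<open>auto simp: fb_solution_def\<close>)
  qed
  with f show ?thesis by blast
qed

end
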